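(* Every modular lattice $L$ can be embedded (as a sublattice), within its variety, into some algebraic strongly spatial lattice. If $L$ has a zero (least element), then the embedding can be taken zero-preserving.
   Context: "$L$ embeds within its variety into $\overline{L}$" means that there is a lattice embedding $L\hookrightarrow\overline{L}$ and $\overline{L}$ belongs to the lattice variety generated by $L$ (that is, $\overline{L}$ satisfies every lattice identity satisfied by $L$). An element $a$ of a lattice $M$ is compact if for every nonempty directed subset $D$ of $M$ with a join, $a\le\bigvee D$ implies $a\le d$ for some $d\in D$. A subset $\Sigma$ of $M$ is join-dense if every element of $M$ is a (possibly infinite or empty) join of elements of $\Sigma$. $M$ is algebraic if it is complete and its set of compact elements is join-dense. A point (completely join-irreducible element) of $M$ is an element $p$ such that the set $\{x\in M\mid x<p\}$ has a largest element; $\mathrm{J}_{\mathrm c}(M)$ denotes the set of points of $M$. A subset $X$ refines a subset $Y$ if every element of $X$ is below some element of $Y$. A finite subset $E\subseteq M$ is a join-cover of $p$ if $p\le\bigvee E$ ($\bigvee\varnothing$ is the least element if it exists; otherwise $\varnothing$ covers nothing); it is a minimal join-cover of $p$ if moreover, for every join-cover $X$ of $p$ refining $E$, one has $E\subseteq X$. $M$ is strongly spatial if $\mathrm{J}_{\mathrm c}(M)$ is join-dense in $M$ and for every point $p$ of $M$ and every join-cover $X$ of $p$, there is a minimal join-cover $I$ of $p$ with $I\subseteq\mathrm{J}_{\mathrm c}(M)$ and $I$ refining $X$. *)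

theory Defs
  imports "HOL-Algebra.Complete_Lattice"
begin

locale modular_lattice = lattice L for L (structure) +
  assumes modular_law:
    "\<lbrakk>x \<in> carrier L; y \<in> carrier L; z \<in> carrier L; x \<sqsubseteq> z\<rbrakk>
      \<Longrightarrow> x \<squnion> (y \<sqinter> z) = (x \<squnion> y) \<sqinter> z"


section \<open>Lattice identities and varieties\<close>

datatype lattice_term =
    Var nat
  | Join lattice_term lattice_term
  | Meet lattice_term lattice_term

primrec term_val :: "('a, 'b) gorder_scheme \<Rightarrow> (nat \<Rightarrow> 'a) \<Rightarrow> lattice_term \<Rightarrow> 'a" where
  "term_val L \<rho> (Var n) = \<rho> n"
| "term_val L \<rho> (Join s t) = term_val L \<rho> s \<squnion>\<^bsub>L\<^esub> term_val L \<rho> t"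
| "term_val L \<rho> (Meet s t) = term_val L \<rho> s \<sqinter>\<^bsub>L\<^esub> term_val L \<rho> t"

definition satisfies_identity ::
    "('a, 'b) gorder_scheme \<Rightarrow> lattice_term \<Rightarrow> lattice_term \<Rightarrow> bool" where
  "satisfies_identity L s t \<longleftrightarrow>
     (\<forall>\<rho> \<in> UNIV \<rightarrow> carrier L. term_val L \<rho> s = term_val L \<rho> t)"

definition in_variety_of :: "('c, 'd) gorder_scheme \<Rightarrow> ('a, 'b) gorder_scheme \<Rightarrow> bool" where
  "in_variety_of M L \<longleftrightarrow>
     lattice M \<and> (\<forall>s t. satisfies_identity L s t \<longrightarrow> satisfies_identity M s t)"

definition lattice_embedding ::
    "('a, 'b) gorder_scheme \<Rightarrow> ('c, 'd) gorder_scheme \<Rightarrow> ('a \<Rightarrow> 'c) \<Rightarrow> bool" where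
  "lattice_embedding L M f \<longleftrightarrow>
     f \<in> carrier L \<rightarrow> carrier M \<and> inj_on f (carrier L) \<and> join_pres L M f \<and> meet_pres L M f"

definition embeds_within_variety ::
    "('a, 'b) gorder_scheme \<Rightarrow> ('c, 'd) gorder_scheme \<Rightarrow> ('a \<Rightarrow> 'c) \<Rightarrow> bool" where
  "embeds_within_variety L M f \<longleftrightarrow> lattice_embedding L M f \<and> in_variety_of M L"


section \<open>Algebraic lattices\<close>

definition directed_in :: "('a, 'b) gorder_scheme \<Rightarrow> 'a set \<Rightarrow> bool" where
  "directed_in M D \<longleftrightarrow>
     D \<subseteq> carrier M \<and> D \<noteq> {} \<and> (\<forall>x\<in>D. \<forall>y\<in>D. \<exists>z\<in>D. x \<sqsubseteq>\<^bsub>M\<^esub> z \<and> y \<sqsubseteq>\<^bsub>M\<^esub> z)"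

definition compact_element :: "('a, 'b) gorder_scheme \<Rightarrow> 'a \<Rightarrow> bool" where
  "compact_element M a \<longleftrightarrow>
     a \<in> carrier M \<and>
     (\<forall>D s. directed_in M D \<longrightarrow> is_lub M s D \<longrightarrow> a \<sqsubseteq>\<^bsub>M\<^esub> s \<longrightarrow> (\<exists>d\<in>D. a \<sqsubseteq>\<^bsub>M\<^esub> d))"

definition join_dense :: "('a, 'b) gorder_scheme \<Rightarrow> 'a set \<Rightarrow> bool" where
  "join_dense M S \<longleftrightarrow> S \<subseteq> carrier M \<and> (\<forall>x\<in>carrier M. \<exists>A. A \<subseteq> S \<and> is_lub M x A)"

definition algebraic_lattice :: "('a, 'b) gorder_scheme \<Rightarrow> bool" where
  "algebraic_lattice M \<longleftrightarrow> complete_lattice M \<and> join_dense M {a. compact_element M a}"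


section \<open>Points, join-covers and strong spatiality\<close>

definition points :: "('a, 'b) gorder_scheme \<Rightarrow> 'a set" where
  "points M = {p \<in> carrier M. \<exists>q. greatest M q {x \<in> carrier M. x \<sqsubset>\<^bsub>M\<^esub> p}}"

definition refines :: "('a, 'b) gorder_scheme \<Rightarrow> 'a set \<Rightarrow> 'a set \<Rightarrow> bool" where
  "refines M X Y \<longleftrightarrow> (\<forall>x\<in>X. \<exists>y\<in>Y. x \<sqsubseteq>\<^bsub>M\<^esub> y)"

text \<open>
  A least upper bound of the empty set is a least element, so the empty set is a join-cover of
  \<open>p\<close> only if \<open>M\<close> has a least element and \<open>p\<close> is below it.
\<close>

definition join_cover :: "('a, 'b) gorder_scheme \<Rightarrow> 'a \<Rightarrow> 'a set \<Rightarrow> bool" where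
  "join_cover M p E \<longleftrightarrow>
     finite E \<and> E \<subseteq> carrier M \<and> (\<exists>s. is_lub M s E \<and> p \<sqsubseteq>\<^bsub>M\<^esub> s)"

definition minimal_join_cover :: "('a, 'b) gorder_scheme \<Rightarrow> 'a \<Rightarrow> 'a set \<Rightarrow> bool" where
  "minimal_join_cover M p E \<longleftrightarrow>
     join_cover M p E \<and> (\<forall>X. join_cover M p X \<longrightarrow> refines M X E \<longrightarrow> E \<subseteq> X)"

definition strongly_spatial :: "('a, 'b) gorder_scheme \<Rightarrow> bool" where
  "strongly_spatial M \<longleftrightarrow>
     join_dense M (points M) \<and>
     (\<forall>p\<in>points M. \<forall>X. join_cover M p X \<longrightarrow>
        (\<exists>I. I \<subseteq> points M \<and> minimal_join_cover M p I \<and> refines M I X))"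

end

theory Submission
  imports Defs
begin

text \<open>
  Order the nonempty filters of \<open>L\<close> by reverse inclusion. By Zorn's lemma every filter is a join
  (intersection) of completely join-irreducible ones, and by modularity, if such a filter \<open>p\<close> lies
  below \<open>x \<or> y\<close>, then \<open>x\<close> and \<open>y\<close> can be shrunk to completely join-irreducible filters (or
  dropped) with \<open>p\<close> still below the join. Hence the sets of completely join-irreducible filters that
  are closed under finite joins, meaning that they contain every such filter below a finite join of
  members, form an algebraic lattice in which \<open>L\<close> embeds via \<open>x \<mapsto> {p. x \<in> p}\<close>. Its points are
  the sets \<open>{q. q \<le> p}\<close>. A join-cover of a point can be shrunk inside the filter lattice until no
  member can be lowered any further, and this gives a minimal join-cover. Finally, \<open>p\<close> belongs to a
  value \<open>t(X\<^sub>1, X\<^sub>2, \<dots>)\<close> iff it lies below \<open>t(E\<^sub>1, E\<^sub>2, \<dots>)\<close>, computed in the filter lattice, for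
  joins \<open>E\<^sub>i\<close> of finitely many members of \<open>X\<^sub>i\<close>, so identities of \<open>L\<close> are inherited.
\<close>

context modular_lattice
begin

subsection \<open>Filters\<close>

definition is_filter :: "'a set \<Rightarrow> bool" where
  "is_filter F \<longleftrightarrow> F \<subseteq> carrier L \<and> F \<noteq> {} \<and> (\<forall>x\<in>F. \<forall>y\<in>F. x \<sqinter> y \<in> F) \<and>
     (\<forall>x\<in>F. \<forall>y\<in>carrier L. x \<sqsubseteq> y \<longrightarrow> y \<in> F)"

text \<open>For filters this is the filter generated by their union: the join under inclusion, hence
  the meet in the reversed order, where joins are intersections.\<close>

definition filter_join :: "'a set \<Rightarrow> 'a set \<Rightarrow> 'a set" where
  "filter_join F G = {c \<in> carrier L. \<exists>u\<in>F. \<exists>v\<in>G. u \<sqinter> v \<sqsubseteq> c}"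

text \<open>Filters with a least proper extension \<open>q\<close>; the witness \<open>a\<close> is any element of \<open>q\<close> outside \<open>p\<close>.\<close>

definition irr :: "'a set set" where
  "irr = {p. is_filter p \<and>
     (\<exists>a\<in>carrier L. a \<notin> p \<and> (\<forall>q. is_filter q \<longrightarrow> p \<subset> q \<longrightarrow> a \<in> q))}"

lemma is_filterD:
  assumes "is_filter F"
  shows "F \<subseteq> carrier L" "F \<noteq> {}"
    "\<And>x y. x \<in> F \<Longrightarrow> y \<in> F \<Longrightarrow> x \<sqinter> y \<in> F"
    "\<And>x y. x \<in> F \<Longrightarrow> x \<sqsubseteq> y \<Longrightarrow> y \<in> carrier L \<Longrightarrow> y \<in> F"
  using assms unfolding is_filter_def by blast+

lemma is_filter_carrier: "carrier L \<noteq> {} \<Longrightarrow> is_filter (carrier L)"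
  unfolding is_filter_def by simp

lemma is_filter_principal:
  assumes "a \<in> carrier L"
  shows "is_filter {c \<in> carrier L. a \<sqsubseteq> c}"
  unfolding is_filter_def using assms by (auto intro: meet_le le_trans)

lemma is_filter_Int:
  assumes F: "is_filter F" and G: "is_filter G"
  shows "is_filter (F \<inter> G)"
proof -
  obtain a b where ab: "a \<in> F" "b \<in> G"
    using is_filterD(2)[OF F] is_filterD(2)[OF G] by blast
  then have abC: "a \<in> carrier L" "b \<in> carrier L"
    using is_filterD(1)[OF F] is_filterD(1)[OF G] by auto
  have "a \<squnion> b \<in> F \<inter> G"
    using ab abC is_filterD(4)[OF F ab(1) join_left] is_filterD(4)[OF G ab(2) join_right] by simp
  then have ne: "F \<inter> G \<noteq> {}" by blast
  show ?thesis
    unfolding is_filter_def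
  proof (intro conjI ballI impI ne)
    show "F \<inter> G \<subseteq> carrier L" using is_filterD(1)[OF F] by (rule le_infI1)
  next
    fix x y assume "x \<in> F \<inter> G" "y \<in> F \<inter> G"
    then show "x \<sqinter> y \<in> F \<inter> G" using is_filterD(3)[OF F] is_filterD(3)[OF G] by simp
  next
    fix x y assume "x \<in> F \<inter> G" "y \<in> carrier L" "x \<sqsubseteq> y"
    then show "y \<in> F \<inter> G" using is_filterD(4)[OF F, of x] is_filterD(4)[OF G, of x] by simp
  qed
qed

text \<open>The empty \<open>E\<close> gives the whole carrier, which is a filter only if
  \<open>L\<close> is nonempty. Later uses get nonemptiness from the existence of an irreducible
  filter.\<close>

lemma is_filter_Inter:
  assumes "carrier L \<noteq> {}" "finite E" "\<And>F. F \<in> E \<Longrightarrow> is_filter F"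
  shows "is_filter (carrier L \<inter> \<Inter>E)"
  using assms(2,3)
proof (induction E rule: finite_induct)
  case empty
  then show ?case using is_filter_carrier[OF assms(1)] by simp
next
  case (insert F E)
  have "carrier L \<inter> \<Inter>(insert F E) = F \<inter> (carrier L \<inter> \<Inter>E)" by auto
  then show ?case using insert is_filter_Int by simp
qed

section \<open>Maximal extensions by Zorn's lemma\<close>

lemma is_filter_Union_chain:
  assumes "\<C> \<noteq> {}" "subset.chain {F. is_filter F} \<C>"
  shows "is_filter (\<Union>\<C>)"
proof -
  have fil: "is_filter F" if "F \<in> \<C>" for F
    using assms(2) that unfolding subset.chain_def by auto
  show ?thesis
    unfolding is_filter_def
  proof (intro conjI ballI impI)
    show "\<Union>\<C> \<subseteq> carrier L" using is_filterD(1)[OF fil] by blast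
    show "\<Union>\<C> \<noteq> {}" using is_filterD(2)[OF fil] assms(1) by blast
  next
    fix x y assume "x \<in> \<Union>\<C>" "y \<in> \<Union>\<C>"
    then obtain F G where xy: "x \<in> F" "y \<in> G" and FG: "F \<in> \<C>" "G \<in> \<C>" by blast
    have "F \<subseteq> G \<or> G \<subseteq> F"
      using assms(2) FG unfolding subset.chain_def by blast
    then show "x \<sqinter> y \<in> \<Union>\<C>"
      using is_filterD(3)[OF fil[OF FG(1)]] is_filterD(3)[OF fil[OF FG(2)]] xy FG by blast
  next
    fix x y assume "x \<in> \<Union>\<C>" and y: "y \<in> carrier L" "x \<sqsubseteq> y"
    then obtain F where "x \<in> F" "F \<in> \<C>" by blast
    then show "y \<in> \<Union>\<C>" using is_filterD(4)[OF fil _ y(2,1)] by blast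
  qed
qed

text \<open>The constraint \<open>G \<inter> Y \<subseteq> p\<close> passes to unions of chains, so
  Zorn's lemma applies. With \<open>Y = {a}\<close> and \<open>p = {}\<close> it says that
  \<open>G\<close> avoids \<open>a\<close>; with filters \<open>Y\<close> and \<open>p\<close> it
  says that \<open>p\<close> lies below the join of \<open>G\<close> and \<open>Y\<close>.\<close>

lemma maximal_filter_extension:
  assumes "is_filter F" "F \<inter> Y \<subseteq> p"
  obtains G where "is_filter G" "F \<subseteq> G" "G \<inter> Y \<subseteq> p"
    "\<And>H. is_filter H \<Longrightarrow> G \<subset> H \<Longrightarrow> \<not> H \<inter> Y \<subseteq> p"
proof -
  let ?A = "{G. is_filter G \<and> F \<subseteq> G \<and> G \<inter> Y \<subseteq> p}"
  have "\<exists>G\<in>?A. \<forall>H\<in>?A. G \<subseteq> H \<longrightarrow> H = G"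
  proof (rule subset_Zorn_nonempty)
    show "?A \<noteq> {}" using assms by blast
    fix \<C> assume ne: "\<C> \<noteq> {}" and ch: "subset.chain ?A \<C>"
    then have "subset.chain {F. is_filter F} \<C>"
      unfolding subset.chain_def by blast
    then have "is_filter (\<Union>\<C>)" by (rule is_filter_Union_chain[OF ne])
    then show "\<Union>\<C> \<in> ?A"
      using ne ch unfolding subset.chain_def by blast
  qed
  then obtain G where G: "G \<in> ?A" "\<forall>H\<in>?A. G \<subseteq> H \<longrightarrow> H = G" ..
  show ?thesis
  proof (rule that[of G])
    fix H assume H: "is_filter H" "G \<subset> H"
    show "\<not> H \<inter> Y \<subseteq> p"
    proof
      assume "H \<inter> Y \<subseteq> p"
      then have "H \<in> ?A" using H G(1) by auto
      then show False using G(2) H(2) by blast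
    qed
  qed (use G(1) in auto)
qed

text \<open>A filter maximal among the extensions of \<open>F\<close> that avoid \<open>a\<close> is
  in \<open>irr\<close>, with \<open>a\<close> itself as the witness.\<close>

lemma exists_irr_separating:
  assumes F: "is_filter F" and a: "a \<in> carrier L" "a \<notin> F"
  obtains p where "p \<in> irr" "F \<subseteq> p" "a \<notin> p"
proof -
  obtain G where "is_filter G" "F \<subseteq> G" "G \<inter> {a} \<subseteq> {}"
    "\<And>H. is_filter H \<Longrightarrow> G \<subset> H \<Longrightarrow> \<not> H \<inter> {a} \<subseteq> {}"
    using maximal_filter_extension[OF F, of "{a}" "{}"] a by blast
  then show ?thesis using that[of G] a unfolding irr_def by blast
qed

section \<open>Generated filters and the modular law for filters\<close>

lemma is_filter_filter_join:
  assumes F: "is_filter F" and G: "is_filter G"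
  shows "is_filter (filter_join F G)" and "F \<subseteq> filter_join F G" and "G \<subseteq> filter_join F G"
proof -
  note FC = is_filterD(1)[OF F] and GC = is_filterD(1)[OF G]
  show FJ: "F \<subseteq> filter_join F G"
  proof
    fix u assume "u \<in> F"
    moreover obtain v where "v \<in> G" using is_filterD(2)[OF G] by blast
    ultimately show "u \<in> filter_join F G"
      using FC GC meet_left[of u v] unfolding filter_join_def by blast
  qed
  show "G \<subseteq> filter_join F G"
  proof
    fix v assume "v \<in> G"
    moreover obtain u where "u \<in> F" using is_filterD(2)[OF F] by blast
    ultimately show "v \<in> filter_join F G"
      using FC GC meet_right[of u v] unfolding filter_join_def by blast
  qed
  have "x \<sqinter> y \<in> filter_join F G"
    if x: "x \<in> filter_join F G" and y: "y \<in> filter_join F G" for x y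
  proof -
    obtain u v where uv: "u \<in> F" "v \<in> G" "u \<sqinter> v \<sqsubseteq> x" and xC: "x \<in> carrier L"
      using x unfolding filter_join_def by blast
    obtain u' v' where uv': "u' \<in> F" "v' \<in> G" "u' \<sqinter> v' \<sqsubseteq> y" and yC: "y \<in> carrier L"
      using y unfolding filter_join_def by blast
    have C: "u \<in> carrier L" "v \<in> carrier L" "u' \<in> carrier L" "v' \<in> carrier L"
      using uv uv' FC GC by auto
    have "(u \<sqinter> u') \<sqinter> (v \<sqinter> v') \<sqsubseteq> u \<sqinter> v"
      using C by (meson meet_le meet_left meet_right meet_closed le_trans)
    moreover have "(u \<sqinter> u') \<sqinter> (v \<sqinter> v') \<sqsubseteq> u' \<sqinter> v'"
      using C by (meson meet_le meet_left meet_right meet_closed le_trans)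
    ultimately have "(u \<sqinter> u') \<sqinter> (v \<sqinter> v') \<sqsubseteq> x \<sqinter> y"
      using C uv uv' xC yC by (meson meet_le meet_closed le_trans)
    then show ?thesis
      using is_filterD(3)[OF F uv(1) uv'(1)] is_filterD(3)[OF G uv(2) uv'(2)] xC yC
      unfolding filter_join_def by auto
  qed
  moreover have "y \<in> filter_join F G"
    if x: "x \<in> filter_join F G" and y: "y \<in> carrier L" "x \<sqsubseteq> y" for x y
  proof -
    obtain u v where uv: "u \<in> F" "v \<in> G" "u \<sqinter> v \<sqsubseteq> x" "x \<in> carrier L"
      using x unfolding filter_join_def by blast
    then have "u \<sqinter> v \<sqsubseteq> y"
      using y FC GC by (meson le_trans meet_closed subsetD)
    then show ?thesis using uv y(1) unfolding filter_join_def by blast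
  qed
  moreover have "filter_join F G \<noteq> {}" using FJ is_filterD(2)[OF F] by blast
  ultimately show "is_filter (filter_join F G)"
    unfolding is_filter_def filter_join_def by blast
qed

lemma filter_join_least:
  assumes "is_filter H" "F \<subseteq> H" "G \<subseteq> H"
  shows "filter_join F G \<subseteq> H"
  using assms is_filterD(3,4)[OF assms(1)] unfolding filter_join_def by blast

text \<open>The nontrivial half of the modular law for filters. Modularity of \<open>L\<close>
  enters only here; everything later goes through this inclusion.\<close>

lemma filter_modular:
  assumes F: "is_filter F" and G: "is_filter G" and H: "is_filter H" and "H \<subseteq> F"
  shows "F \<inter> filter_join G H \<subseteq> filter_join (F \<inter> G) H"
proof
  fix c assume "c \<in> F \<inter> filter_join G H"
  then obtain v w where c: "c \<in> F" and v: "v \<in> G" and w: "w \<in> H" and le: "v \<sqinter> w \<sqsubseteq> c"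
    unfolding filter_join_def by blast
  have wF: "w \<in> F" using w assms(4) by auto
  have C: "c \<in> carrier L" "v \<in> carrier L" "w \<in> carrier L"
    using c v w F G H is_filterD(1) by blast+
  \<comment> \<open>This element is in \<open>F\<close> because \<open>c\<close> and
    \<open>w\<close> are, and in \<open>G\<close> because it is above \<open>v\<close>. The modular
    law rewrites its meet with \<open>w\<close> as a join of two elements below
    \<open>c\<close>.\<close>
  have "(c \<sqinter> w) \<squnion> v \<in> F \<inter> G"
    using is_filterD(4)[OF F is_filterD(3)[OF F c wF] join_left]
      is_filterD(4)[OF G v join_right] C by simp
  moreover have "((c \<sqinter> w) \<squnion> v) \<sqinter> w = (c \<sqinter> w) \<squnion> (v \<sqinter> w)"
    using modular_law[of "c \<sqinter> w" v w] C by (simp add: meet_right)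
  then have "((c \<sqinter> w) \<squnion> v) \<sqinter> w \<sqsubseteq> c"
    using C le by (simp add: join_le meet_left)
  ultimately show "c \<in> filter_join (F \<inter> G) H"
    using w C unfolding filter_join_def by blast
qed

subsection \<open>Irreducible filters and modularity\<close>

lemma irrD: "p \<in> irr \<Longrightarrow> is_filter p"
  unfolding irr_def by blast

text \<open>
  In the lattice of filters ordered by reverse inclusion, \<open>x\<close> is minimal with \<open>p \<le> x \<or> y\<close>; the
  interval from \<open>y\<close> to \<open>x \<or> y = p \<or> y\<close> is then isomorphic to the one from \<open>p \<and> y\<close> to \<open>p\<close>, and this
  transports the unique lower cover of \<open>p\<close> to \<open>x\<close>.
\<close>

lemma maximal_filter_irr:
  assumes p: "p \<in> irr" and x: "is_filter x" and y: "is_filter y"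
    and le: "x \<inter> y \<subseteq> p" and nle: "\<not> y \<subseteq> p"
    and max: "\<And>H. is_filter H \<Longrightarrow> x \<subset> H \<Longrightarrow> \<not> H \<inter> y \<subseteq> p"
  shows "x \<in> irr"
proof -
  obtain a where a: "a \<in> carrier L" "a \<notin> p" "\<And>q. is_filter q \<Longrightarrow> p \<subset> q \<Longrightarrow> a \<in> q"
    using p unfolding irr_def by blast
  note pf = irrD[OF p]
  let ?A = "{c \<in> carrier L. a \<sqsubseteq> c}"
  note A = is_filter_principal[OF a(1)]
  \<comment> \<open>The least filter properly containing \<open>p\<close>, that is, the unique lower
    cover of \<open>p\<close> in the reversed order; see \<open>qleast\<close>.\<close>
  let ?q = "filter_join p ?A"
  note q = is_filter_filter_join[OF pf A]
  have aq: "a \<in> ?q" using q(3) a(1) by auto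
  have qleast: "?q \<subseteq> r" if "is_filter r" "p \<subset> r" for r
    using a(3)[OF that] that is_filterD(4)[OF that(1)] by (intro filter_join_least) auto
  note py = is_filter_Int[OF pf y]
  \<comment> \<open>By modularity, adjoining \<open>p \<inter> y\<close> to \<open>x\<close> keeps
    the intersection with \<open>y\<close> inside \<open>p\<close>; by maximality of
    \<open>x\<close>, nothing was added.\<close>
  have pyx: "p \<inter> y \<subseteq> x"
  proof -
    let ?H = "filter_join x (p \<inter> y)"
    note H = is_filter_filter_join[OF x py]
    have "y \<inter> ?H \<subseteq> filter_join (y \<inter> x) (p \<inter> y)"
      using filter_modular[OF y x py] by blast
    also have "\<dots> \<subseteq> p" using le by (intro filter_join_least[OF pf]) auto
    finally have "?H = x" using max[OF H(1)] H(2) by blast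
    then show ?thesis using H(3) by simp
  qed
  \<comment> \<open>By maximality \<open>z \<inter> y\<close> is not inside \<open>p\<close>, so
    together with \<open>p\<close> it generates a proper extension of \<open>p\<close>, which
    contains \<open>?q\<close>. Modularity brings the intersection of that extension with
    \<open>y\<close> back into \<open>z\<close>.\<close>
  have above: "?q \<inter> y \<subseteq> z" if z: "is_filter z" "x \<subset> z" for z
  proof -
    note zy = is_filter_Int[OF z(1) y]
    note J = is_filter_filter_join[OF pf zy]
    have "p \<subset> filter_join p (z \<inter> y)"
      using J(2,3) max[OF z] by blast
    then have "?q \<inter> y \<subseteq> y \<inter> filter_join p (z \<inter> y)" using qleast[OF J(1)] by blast
    also have "\<dots> \<subseteq> filter_join (y \<inter> p) (z \<inter> y)"
      using filter_modular[OF y pf zy] by blast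
    also have "\<dots> \<subseteq> z" using pyx z by (intro filter_join_least) auto
    finally show ?thesis .
  qed
  \<comment> \<open>Otherwise \<open>?q \<inter> y\<close> is inside \<open>p\<close>. As
    \<open>a\<close> lies in \<open>?q\<close> and in the filter generated by \<open>y\<close> and
    \<open>p\<close>, modularity would put \<open>a\<close> into \<open>p\<close>. An element
    \<open>b\<close> that escapes \<open>x\<close> then witnesses
    \<open>x \<in> irr\<close>.\<close>
  have "\<not> ?q \<inter> y \<subseteq> x"
  proof
    assume "?q \<inter> y \<subseteq> x"
    then have "?q \<inter> y \<subseteq> p" using le by blast
    note J = is_filter_filter_join[OF y pf]
    have "p \<subset> filter_join y p" using J(2,3) nle by blast
    then have "a \<in> ?q \<inter> filter_join y p" using aq a(3)[OF J(1)] by blast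
    also have "\<dots> \<subseteq> filter_join (?q \<inter> y) p" by (rule filter_modular[OF q(1) y pf q(2)])
    also have "\<dots> \<subseteq> p" using \<open>?q \<inter> y \<subseteq> p\<close> by (intro filter_join_least[OF pf]) auto
    finally show False using a(2) by simp
  qed
  then obtain b where b: "b \<in> ?q \<inter> y" "b \<notin> x" by blast
  moreover have "b \<in> carrier L" using b is_filterD(1)[OF y] by blast
  ultimately show ?thesis using x above unfolding irr_def by blast
qed

text \<open>First enlarge \<open>x\<close> against \<open>y\<close>, then \<open>y\<close> against
  the enlarged \<open>x\<close>. Each enlargement is irreducible by
  \<open>maximal_filter_irr\<close> unless the other side alone is contained in \<open>p\<close>,
  and in that case a single irreducible filter suffices.\<close>

lemma irr_join_decomposition:
  assumes p: "p \<in> irr" and x: "is_filter x" and y: "is_filter y" and le: "x \<inter> y \<subseteq> p"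
  obtains E where "finite E" "E \<subseteq> irr" "\<forall>q\<in>E. x \<subseteq> q \<or> y \<subseteq> q" "carrier L \<inter> \<Inter>E \<subseteq> p"
proof -
  consider "y \<subseteq> p" | "\<not> y \<subseteq> p" by blast
  then show ?thesis
  proof cases
    case 1
    then show ?thesis using that[of "{p}"] p by auto
  next
    case 2
    obtain x' where x': "is_filter x'" "x \<subseteq> x'" "x' \<inter> y \<subseteq> p"
      "\<And>H. is_filter H \<Longrightarrow> x' \<subset> H \<Longrightarrow> \<not> H \<inter> y \<subseteq> p"
      using maximal_filter_extension[OF x le] by blast
    have x'irr: "x' \<in> irr" by (rule maximal_filter_irr[OF p x'(1) y x'(3) 2 x'(4)])
    show ?thesis
    proof (cases "x' \<subseteq> p")
      case True
      then show ?thesis using that[of "{x'}"] x' x'irr by auto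
    next
      case False
      have "y \<inter> x' \<subseteq> p" using x'(3) by blast
      then obtain y' where y': "is_filter y'" "y \<subseteq> y'" "y' \<inter> x' \<subseteq> p"
        "\<And>H. is_filter H \<Longrightarrow> y' \<subset> H \<Longrightarrow> \<not> H \<inter> x' \<subseteq> p"
        using maximal_filter_extension[OF y] by blast
      have "y' \<in> irr" by (rule maximal_filter_irr[OF p y'(1) x'(1) y'(3) False y'(4)])
      moreover have "carrier L \<inter> \<Inter>{x', y'} \<subseteq> p" using y'(3) by auto
      ultimately show ?thesis using that[of "{x', y'}"] x'(2) x'irr y'(2) by blast
    qed
  qed
qed

section \<open>Tight covers\<close>

text \<open>As the order is reverse inclusion, lowering a member \<open>d\<close> of a cover means enlarging it to a filter
  \<open>x\<close>. The intersection with the carrier makes the join of the empty family the least filter.\<close>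

definition tight_cover :: "'a set \<Rightarrow> 'a set set \<Rightarrow> 'a set set \<Rightarrow> bool" where
  "tight_cover p E D \<longleftrightarrow>
     (\<forall>d\<in>D. \<forall>x. is_filter x \<longrightarrow> d \<subset> x \<longrightarrow> \<not> carrier L \<inter> x \<inter> \<Inter>(E - {d}) \<subseteq> p)"

lemma tight_cover_antimono:
  assumes "tight_cover p E D" "E' \<subseteq> E"
  shows "tight_cover p E' D"
  unfolding tight_cover_def
proof (intro ballI allI impI)
  fix d x assume "d \<in> D" "is_filter x" "d \<subset> x"
  then have "\<not> carrier L \<inter> x \<inter> \<Inter>(E - {d}) \<subseteq> p"
    using assms(1) unfolding tight_cover_def by blast
  moreover have "\<Inter>(E - {d}) \<subseteq> \<Inter>(E' - {d})" using assms(2) by (intro Inter_anti_mono) auto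
  ultimately show "\<not> carrier L \<inter> x \<inter> \<Inter>(E' - {d}) \<subseteq> p" by blast
qed

text \<open>The elements of \<open>B\<close> are tightened one at a time; a tightening of one element preserves the
  tightness of those in \<open>A\<close>, because it only makes the remaining cover smaller.\<close>

lemma exists_tight_cover_aux:
  assumes p: "p \<in> irr" and "finite B"
  shows "finite A \<Longrightarrow> A \<subseteq> irr \<Longrightarrow> B \<subseteq> irr \<Longrightarrow> carrier L \<inter> \<Inter>(A \<union> B) \<subseteq> p \<Longrightarrow>
    tight_cover p (A \<union> B) A \<Longrightarrow>
    \<exists>D. finite D \<and> D \<subseteq> irr \<and> carrier L \<inter> \<Inter>D \<subseteq> p \<and> tight_cover p D D \<and>
        (\<forall>d\<in>D. \<exists>e\<in>A \<union> B. e \<subseteq> d)"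
  using assms(2)
proof (induction B arbitrary: A rule: finite_induct)
  case empty
  then show ?case by (intro exI[of _ A]) auto
next
  case (insert q B)
  have ne: "carrier L \<noteq> {}" using p unfolding irr_def by blast
  show ?case
  \<comment> \<open>If the rest already covers \<open>p\<close>, drop \<open>q\<close>. Otherwise
    this failure is the hypothesis under which a maximal extension of \<open>q\<close> is
    irreducible.\<close>
  proof (cases "carrier L \<inter> \<Inter>(A \<union> B) \<subseteq> p")
    case True
    have "tight_cover p (A \<union> B) A"
      using insert.prems(5) by (rule tight_cover_antimono) auto
    then obtain D where "finite D" "D \<subseteq> irr" "carrier L \<inter> \<Inter>D \<subseteq> p" "tight_cover p D D"
        "\<forall>d\<in>D. \<exists>e\<in>A \<union> B. e \<subseteq> d"
      using insert.IH[OF insert.prems(1,2) _ True] insert.prems(3) by auto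
    moreover have "\<forall>d\<in>D. \<exists>e\<in>A \<union> insert q B. e \<subseteq> d" using calculation(5) by blast
    ultimately show ?thesis by blast
  next
    case False
    let ?Y = "carrier L \<inter> \<Inter>(A \<union> B)"
    have Y: "is_filter ?Y"
      using insert.prems insert.hyps by (intro is_filter_Inter[OF ne]) (auto dest: irrD)
    have q: "is_filter q" using insert.prems(3) irrD by blast
    have "q \<inter> ?Y \<subseteq> p" using insert.prems(4) by auto
    then obtain q' where q': "is_filter q'" "q \<subseteq> q'" "q' \<inter> ?Y \<subseteq> p"
      "\<And>H. is_filter H \<Longrightarrow> q' \<subset> H \<Longrightarrow> \<not> H \<inter> ?Y \<subseteq> p"
      using maximal_filter_extension[OF q] by blast
    have q'irr: "q' \<in> irr" by (rule maximal_filter_irr[OF p q'(1) Y q'(3) False q'(4)])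
    \<comment> \<open>Either membership would give \<open>?Y \<subseteq> q'\<close>, hence
      \<open>?Y \<subseteq> p\<close>.\<close>
    have notin: "q' \<notin> A \<union> B" "q \<notin> A \<union> B" using q'(2,3) False by blast+
    have eq: "insert q' (A \<union> B) - {q'} = A \<union> B" using notin by blast
    have "tight_cover p (insert q' A \<union> B) (insert q' A)"
      unfolding tight_cover_def
    proof (intro ballI allI impI)
      fix d x assume d: "d \<in> insert q' A" and x: "is_filter x" "d \<subset> x"
      show "\<not> carrier L \<inter> x \<inter> \<Inter>(insert q' A \<union> B - {d}) \<subseteq> p"
      proof (cases "d = q'")
        case True
        then have "\<not> x \<inter> ?Y \<subseteq> p" using q'(4) x by blast
        then show ?thesis using True eq by (auto simp: Int_ac)
      next
        case False
        then have dA: "d \<in> A" using d by blast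
        then have "d \<noteq> q" using notin by blast
        have "\<not> carrier L \<inter> x \<inter> \<Inter>(A \<union> insert q B - {d}) \<subseteq> p"
          using insert.prems(5) dA x unfolding tight_cover_def by blast
        moreover have "carrier L \<inter> x \<inter> \<Inter>(A \<union> insert q B - {d})
            \<subseteq> carrier L \<inter> x \<inter> \<Inter>(insert q' A \<union> B - {d})"
          using q'(2) \<open>d \<noteq> q\<close> by blast
        ultimately show ?thesis by blast
      qed
    qed
    moreover have "carrier L \<inter> \<Inter>(insert q' A \<union> B) \<subseteq> p" using q'(3) by auto
    ultimately obtain D where "finite D" "D \<subseteq> irr" "carrier L \<inter> \<Inter>D \<subseteq> p" "tight_cover p D D"
        "\<forall>d\<in>D. \<exists>e\<in>insert q' A \<union> B. e \<subseteq> d"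
      using insert.IH[of "insert q' A"] insert.prems(1-3) q'irr by auto
    moreover have "\<forall>d\<in>D. \<exists>e\<in>A \<union> insert q B. e \<subseteq> d"
    proof
      fix d assume "d \<in> D"
      then obtain e where "e \<in> insert q' A \<union> B" "e \<subseteq> d" using calculation(5) by blast
      then show "\<exists>e\<in>A \<union> insert q B. e \<subseteq> d"
        using q'(2) by (cases "e = q'") auto
    qed
    ultimately show ?thesis by blast
  qed
qed

lemma exists_tight_cover:
  assumes "p \<in> irr" "finite E" "E \<subseteq> irr" "carrier L \<inter> \<Inter>E \<subseteq> p"
  obtains D where "finite D" "D \<subseteq> irr" "carrier L \<inter> \<Inter>D \<subseteq> p" "tight_cover p D D"
    "\<And>d. d \<in> D \<Longrightarrow> \<exists>e\<in>E. e \<subseteq> d"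
proof -
  have "tight_cover p ({} \<union> E) {}" unfolding tight_cover_def by simp
  moreover have "carrier L \<inter> \<Inter>({} \<union> E) \<subseteq> p" using assms(4) by simp
  ultimately show ?thesis
    using exists_tight_cover_aux[OF assms(1,2) finite.emptyI empty_subsetI assms(3)] that
    unfolding Un_empty_left by blast
qed

subsection \<open>The lattice of closed sets of irreducible filters\<close>

text \<open>The last condition says that \<open>p\<close> lies below the join of \<open>E\<close>.
  For \<open>E = {}\<close> it fails, since members of \<open>irr\<close> are proper filters; so
  \<open>cl {} = {}\<close>.\<close>

definition cl :: "'a set set \<Rightarrow> 'a set set" where
  "cl A = {p \<in> irr. \<exists>E. finite E \<and> E \<subseteq> A \<and> carrier L \<inter> \<Inter>E \<subseteq> p}"

definition closed_sets :: "'a set set gorder" where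
  "closed_sets = \<lparr>carrier = {X. X \<subseteq> irr \<and> cl X \<subseteq> X}, eq = (=), le = (\<subseteq>)\<rparr>"

lemma closed_sets_simps [simp]:
  "le closed_sets = (\<subseteq>)" "eq closed_sets = (=)"
  "carrier closed_sets = {X. X \<subseteq> irr \<and> cl X \<subseteq> X}"
  by (auto simp: closed_sets_def)

lemma cl_subset_irr: "cl A \<subseteq> irr"
  unfolding cl_def by blast

lemma clI: "p \<in> irr \<Longrightarrow> finite E \<Longrightarrow> E \<subseteq> A \<Longrightarrow> carrier L \<inter> \<Inter>E \<subseteq> p \<Longrightarrow> p \<in> cl A"
  unfolding cl_def by blast

lemma clE:
  assumes "p \<in> cl A"
  obtains E where "p \<in> irr" "finite E" "E \<subseteq> A" "carrier L \<inter> \<Inter>E \<subseteq> p"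
  using assms unfolding cl_def by blast

lemma cl_mono: "A \<subseteq> B \<Longrightarrow> cl A \<subseteq> cl B"
  unfolding cl_def by blast

lemma subset_cl: "A \<subseteq> irr \<Longrightarrow> A \<subseteq> cl A"
  by (auto intro: clI[of _ "{p}" for p])

text \<open>Finitely many finite covers combine into one: each \<open>q\<close> in \<open>E\<close>
  is replaced by a finite family \<open>D q\<close> whose join is above it.\<close>

lemma cl_cl: "cl (cl A) \<subseteq> cl A"
proof
  fix p assume "p \<in> cl (cl A)"
  then obtain E where p: "p \<in> irr" and E: "finite E" "E \<subseteq> cl A" "carrier L \<inter> \<Inter>E \<subseteq> p"
    by (rule clE)
  have "\<forall>q\<in>E. \<exists>D. finite D \<and> D \<subseteq> A \<and> carrier L \<inter> \<Inter>D \<subseteq> q"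
    using E(2) unfolding cl_def by blast
  then obtain D where D: "\<And>q. q \<in> E \<Longrightarrow> finite (D q) \<and> D q \<subseteq> A \<and> carrier L \<inter> \<Inter>(D q) \<subseteq> q"
    by metis
  have "carrier L \<inter> \<Inter>(\<Union>(D ` E)) \<subseteq> q" if "q \<in> E" for q
  proof -
    have "D q \<subseteq> \<Union>(D ` E)" using that by blast
    then have "carrier L \<inter> \<Inter>(\<Union>(D ` E)) \<subseteq> carrier L \<inter> \<Inter>(D q)"
      by (meson Int_mono Inter_anti_mono order_refl)
    also have "\<dots> \<subseteq> q" using D[OF that] by simp
    finally show ?thesis .
  qed
  then have "carrier L \<inter> \<Inter>(\<Union>(D ` E)) \<subseteq> carrier L \<inter> \<Inter>E"
    by (intro Int_greatest Int_lower1 Inter_greatest)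
  then show "p \<in> cl A"
    using D E p by (intro clI[of p "\<Union>(D ` E)"]) auto
qed

lemma cl_in_carrier: "cl A \<in> carrier closed_sets"
  using cl_subset_irr cl_cl by simp

lemma cl_least: "X \<in> carrier closed_sets \<Longrightarrow> A \<subseteq> X \<Longrightarrow> cl A \<subseteq> X"
  using cl_mono[of A X] by auto

lemma cl_singleton: "p \<in> irr \<Longrightarrow> cl {p} = {q \<in> irr. p \<subseteq> q}"
proof (intro equalityI subsetI)
  fix q assume p: "p \<in> irr" and "q \<in> cl {p}"
  then obtain E where q: "q \<in> irr" and "E \<subseteq> {p}" "carrier L \<inter> \<Inter>E \<subseteq> q"
    by (elim clE)
  then have "p \<subseteq> q" using is_filterD(1)[OF irrD[OF p]] by blast
  then show "q \<in> {q \<in> irr. p \<subseteq> q}" using q by simp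
next
  fix q assume "p \<in> irr" "q \<in> {q \<in> irr. p \<subseteq> q}"
  then show "q \<in> cl {p}" by (intro clI[of _ "{p}"]) auto
qed

section \<open>Completeness and lattice operations\<close>

lemma partial_order_closed_sets: "partial_order closed_sets"
  by standard auto

text \<open>An equivalence, so that the least upper bounds in the definitions of compactness and of
  join-covers can be replaced by \<open>cl\<close>.\<close>

lemma closed_sets_lub:
  assumes "\<X> \<subseteq> carrier closed_sets"
  shows "is_lub closed_sets s \<X> \<longleftrightarrow> s = cl (\<Union>\<X>)"
proof -
  have "\<Union>\<X> \<subseteq> irr" using assms by auto
  then have *: "is_lub closed_sets (cl (\<Union>\<X>)) \<X>"
  proof (intro least_UpperI)
    fix Y assume "Y \<in> Upper closed_sets \<X>"
    then have "Y \<in> carrier closed_sets" "\<Union>\<X> \<subseteq> Y"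
      using assms unfolding Upper_def closed_sets_simps by blast+
    then show "cl (\<Union>\<X>) \<sqsubseteq>\<^bsub>closed_sets\<^esub> Y" using cl_least[of Y "\<Union>\<X>"] by simp
  next
    fix X assume "X \<in> \<X>"
    then show "X \<sqsubseteq>\<^bsub>closed_sets\<^esub> cl (\<Union>\<X>)"
      using subset_cl[OF \<open>\<Union>\<X> \<subseteq> irr\<close>] by auto
  qed (use assms cl_in_carrier in simp_all)
  show ?thesis using partial_order.least_unique[OF partial_order_closed_sets _ *] * by metis
qed

text \<open>The factor \<open>irr\<close> supplies the top element when the family is empty.\<close>

lemma closed_sets_glb:
  assumes "\<X> \<subseteq> carrier closed_sets"
  shows "is_glb closed_sets i \<X> \<longleftrightarrow> i = irr \<inter> \<Inter>\<X>"
proof -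
  have *: "is_glb closed_sets (irr \<inter> \<Inter>\<X>) \<X>"
  proof (rule greatest_LowerI)
    have "cl (irr \<inter> \<Inter>\<X>) \<subseteq> X" if "X \<in> \<X>" for X
    proof (rule cl_least)
      show "X \<in> carrier closed_sets" by (rule subsetD[OF assms that])
      show "irr \<inter> \<Inter>\<X> \<subseteq> X" using that by blast
    qed
    then have "cl (irr \<inter> \<Inter>\<X>) \<subseteq> irr \<inter> \<Inter>\<X>"
      by (intro Int_greatest cl_subset_irr Inter_greatest)
    then show "irr \<inter> \<Inter>\<X> \<in> carrier closed_sets" by simp
  next
    fix X assume "X \<in> \<X>"
    then show "irr \<inter> \<Inter>\<X> \<sqsubseteq>\<^bsub>closed_sets\<^esub> X" by auto
  next
    fix Y assume Y: "Y \<in> Lower closed_sets \<X>"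
    have "Y \<subseteq> X" if "X \<in> \<X>" for X using Lower_memD[OF Y that assms] by simp
    moreover have "Y \<subseteq> irr" using Y unfolding Lower_def by simp
    ultimately show "Y \<sqsubseteq>\<^bsub>closed_sets\<^esub> irr \<inter> \<Inter>\<X>" by auto
  qed (rule assms)
  show ?thesis using partial_order.greatest_unique[OF partial_order_closed_sets _ *] * by metis
qed

lemma complete_lattice_closed_sets: "complete_lattice closed_sets"
  by (rule partial_order.complete_latticeI[OF partial_order_closed_sets])
    (auto simp: closed_sets_lub closed_sets_glb)

lemma join_closed_sets:
  assumes "X \<in> carrier closed_sets" "Y \<in> carrier closed_sets"
  shows "X \<squnion>\<^bsub>closed_sets\<^esub> Y = cl (X \<union> Y)"
proof -
  interpret complete_lattice closed_sets by (rule complete_lattice_closed_sets)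
  show ?thesis
    using sup_of_two_least[OF assms] closed_sets_lub[of "{X, Y}"] assms
    by (simp add: join_def del: closed_sets_simps)
qed

lemma meet_closed_sets:
  assumes "X \<in> carrier closed_sets" "Y \<in> carrier closed_sets"
  shows "X \<sqinter>\<^bsub>closed_sets\<^esub> Y = X \<inter> Y"
proof -
  interpret complete_lattice closed_sets by (rule complete_lattice_closed_sets)
  have "X \<sqinter>\<^bsub>closed_sets\<^esub> Y = irr \<inter> \<Inter>{X, Y}"
    using inf_of_two_greatest[OF assms] closed_sets_glb[of "{X, Y}"] assms
    by (simp add: meet_def del: closed_sets_simps)
  then show ?thesis using assms by auto
qed

section \<open>Algebraicity and points\<close>

lemma closed_sets_lub_singletons:
  assumes "X \<in> carrier closed_sets"
  shows "is_lub closed_sets X ((\<lambda>p. cl {p}) ` X)"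
proof -
  have "cl {p} \<subseteq> X" if "p \<in> X" for p using that assms by (intro cl_least) auto
  moreover have "p \<in> cl {p}" if "p \<in> X" for p using that assms subset_cl[of "{p}"] by auto
  ultimately have "\<Union>((\<lambda>p. cl {p}) ` X) = X" by blast
  moreover have "cl X = X" using assms subset_cl[of X] by auto
  moreover have "(\<lambda>p. cl {p}) ` X \<subseteq> carrier closed_sets" using cl_in_carrier by blast
  ultimately show ?thesis by (simp only: closed_sets_lub)
qed

text \<open>Membership of \<open>p\<close> in the join of a directed family is due to a finite
  \<open>E\<close>, and directedness puts all of \<open>E\<close> into one member.\<close>

lemma compact_cl_singleton:
  assumes "p \<in> irr"
  shows "compact_element closed_sets (cl {p})"
  unfolding compact_element_def
proof (intro conjI allI impI)
  fix \<D> s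
  assume dir: "directed_in closed_sets \<D>" and lub: "is_lub closed_sets s \<D>"
    and le: "cl {p} \<sqsubseteq>\<^bsub>closed_sets\<^esub> s"
  have DC: "\<D> \<subseteq> carrier closed_sets" using dir unfolding directed_in_def by blast
  have "p \<in> s" using le assms subset_cl[of "{p}"] by auto
  then have "p \<in> cl (\<Union>\<D>)" using lub closed_sets_lub[OF DC] by simp
  then obtain E where E: "finite E" "E \<subseteq> \<Union>\<D>" "carrier L \<inter> \<Inter>E \<subseteq> p" by (rule clE)
  have "\<exists>X\<in>\<D>. E \<subseteq> X"
    using E(1,2)
  proof (induction E rule: finite_induct)
    case empty
    then show ?case using dir unfolding directed_in_def by blast
  next
    case (insert q E)
    then obtain X Y where "X \<in> \<D>" "E \<subseteq> X" "Y \<in> \<D>" "q \<in> Y" by auto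
    moreover then obtain Z where "Z \<in> \<D>" "X \<subseteq> Z" "Y \<subseteq> Z"
      using dir unfolding directed_in_def closed_sets_simps by meson
    ultimately show ?case by blast
  qed
  then obtain X where X: "X \<in> \<D>" "E \<subseteq> X" by blast
  then have "p \<in> X" using clI[OF assms E(1) X(2) E(3)] DC by auto
  then have "cl {p} \<subseteq> X" using X DC by (intro cl_least) auto
  then show "\<exists>X\<in>\<D>. cl {p} \<sqsubseteq>\<^bsub>closed_sets\<^esub> X" using X by auto
qed (rule cl_in_carrier)

lemma algebraic_closed_sets: "algebraic_lattice closed_sets"
  unfolding algebraic_lattice_def join_dense_def
proof (intro conjI ballI)
  fix X assume X: "X \<in> carrier closed_sets"
  then have "(\<lambda>p. cl {p}) ` X \<subseteq> {a. compact_element closed_sets a}"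
    using compact_cl_singleton by auto
  then show "\<exists>A\<subseteq>{a. compact_element closed_sets a}. is_lub closed_sets X A"
    using closed_sets_lub_singletons[OF X] by blast
qed (use complete_lattice_closed_sets in \<open>auto simp: compact_element_def\<close>)

lemma points_closed_sets: "points closed_sets = (\<lambda>p. cl {p}) ` irr"
proof (intro equalityI subsetI)
  fix X assume "X \<in> points closed_sets"
  then obtain Y where X: "X \<in> carrier closed_sets"
    and Y: "greatest closed_sets Y {Z \<in> carrier closed_sets. Z \<subset> X}"
    unfolding points_def lless_def psubset_eq by auto
  have "Y \<subset> X" using Y greatest_mem by fastforce
  \<comment> \<open>Any \<open>p\<close> in \<open>X\<close> outside the largest proper closed
    subset generates \<open>X\<close>, because a proper \<open>cl {p}\<close> would lie inside
    \<open>Y\<close>.\<close>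
  then obtain p where p: "p \<in> X" "p \<notin> Y" by blast
  then have pirr: "p \<in> irr" using X by auto
  have sub: "cl {p} \<subseteq> X" using p X by (intro cl_least) auto
  have "p \<in> cl {p}" using subset_cl[of "{p}"] pirr by auto
  have "cl {p} = X"
  proof (rule ccontr)
    assume "cl {p} \<noteq> X"
    then have "cl {p} \<in> {Z \<in> carrier closed_sets. Z \<subset> X}" using sub cl_in_carrier by blast
    then have "cl {p} \<subseteq> Y" using greatest_le[OF Y] by simp
    then show False using p \<open>p \<in> cl {p}\<close> by blast
  qed
  then show "X \<in> (\<lambda>p. cl {p}) ` irr" using pirr by blast
next
  fix X assume "X \<in> (\<lambda>p. cl {p}) ` irr"
  then obtain p where p: "p \<in> irr" and X: "X = cl {p}" by blast
  obtain a where a: "a \<in> carrier L" "a \<notin> p" "\<And>q. is_filter q \<Longrightarrow> p \<subset> q \<Longrightarrow> a \<in> q"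
    using p unfolding irr_def by blast
  let ?Y = "{q \<in> irr. p \<subset> q}"
  \<comment> \<open>Dropping \<open>p\<close> from \<open>cl {p}\<close> leaves a closed set: the
    witness \<open>a\<close> is in every member of \<open>?Y\<close>, hence in every filter below a
    finite join of them, but not in \<open>p\<close>.\<close>
  have "cl ?Y \<subseteq> ?Y"
  proof
    fix q assume "q \<in> cl ?Y"
    then obtain E where q: "q \<in> irr" and E: "E \<subseteq> ?Y" "carrier L \<inter> \<Inter>E \<subseteq> q" by (rule clE)
    have "a \<in> q" using E a irrD by blast
    moreover have "p \<subseteq> q" using E is_filterD(1)[OF irrD[OF p]] by blast
    ultimately show "q \<in> ?Y" using q a(2) by blast
  qed
  then have Y: "?Y \<in> carrier closed_sets" by auto
  have "greatest closed_sets ?Y {Z \<in> carrier closed_sets. Z \<subset> X}"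
    unfolding greatest_def
  proof (intro conjI ballI)
    have "?Y \<subset> X" using p unfolding X cl_singleton[OF p] by blast
    then show "?Y \<in> {Z \<in> carrier closed_sets. Z \<subset> X}" using Y by blast
    fix Z assume Z: "Z \<in> {Z \<in> carrier closed_sets. Z \<subset> X}"
    then have "p \<notin> Z" using cl_least[of Z "{p}"] X by blast
    then show "Z \<sqsubseteq>\<^bsub>closed_sets\<^esub> ?Y" using Z unfolding X cl_singleton[OF p] by auto
  qed blast
  then show "X \<in> points closed_sets"
    unfolding points_def lless_def using cl_in_carrier X by (auto simp: psubset_eq)
qed

subsection \<open>Strong spatiality\<close>

text \<open>A refining cover that omits \<open>cl {d}\<close> can use only filters strictly below
  \<open>d\<close> in place of \<open>d\<close>. These all lie below the lower cover
  \<open>filter_join d ?A\<close> of \<open>d\<close>, so \<open>d\<close> could be lowered, against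
  tightness.\<close>

lemma minimal_join_cover_tight:
  assumes p: "p \<in> irr" and D: "finite D" "D \<subseteq> irr" "carrier L \<inter> \<Inter>D \<subseteq> p"
    and tight: "tight_cover p D D"
  shows "minimal_join_cover closed_sets (cl {p}) ((\<lambda>d. cl {d}) ` D)"
  unfolding minimal_join_cover_def
proof (intro conjI allI impI)
  let ?I = "(\<lambda>d. cl {d}) ` D"
  have IC: "?I \<subseteq> carrier closed_sets" by (rule image_subsetI) (rule cl_in_carrier)
  have "D \<subseteq> \<Union>?I" using subset_cl[of "{d}" for d] D(2) by auto
  then have "p \<in> cl (\<Union>?I)" using p D by (intro clI[of p D]) auto
  then have "cl {p} \<subseteq> cl (\<Union>?I)" by (intro cl_least cl_in_carrier) auto
  then show "join_cover closed_sets (cl {p}) ?I"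
    using D(1) IC closed_sets_lub[OF IC] unfolding join_cover_def by auto
next
  fix \<Z> assume cov: "join_cover closed_sets (cl {p}) \<Z>"
    and ref: "refines closed_sets \<Z> ((\<lambda>d. cl {d}) ` D)"
  have ZC: "\<Z> \<subseteq> carrier closed_sets" using cov unfolding join_cover_def by blast
  have "cl {p} \<subseteq> cl (\<Union>\<Z>)"
    using cov closed_sets_lub[OF ZC] unfolding join_cover_def by auto
  then have "p \<in> cl (\<Union>\<Z>)" using subset_cl[of "{p}"] p by auto
  then obtain G where G: "G \<subseteq> \<Union>\<Z>" "carrier L \<inter> \<Inter>G \<subseteq> p" by (rule clE)
  show "(\<lambda>d. cl {d}) ` D \<subseteq> \<Z>"
  proof (rule ccontr)
    assume "\<not> (\<lambda>d. cl {d}) ` D \<subseteq> \<Z>"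
    then obtain d where d: "d \<in> D" "cl {d} \<notin> \<Z>" by blast
    have dirr: "d \<in> irr" using d D by blast
    obtain a where a: "a \<in> carrier L" "a \<notin> d" "\<And>q. is_filter q \<Longrightarrow> d \<subset> q \<Longrightarrow> a \<in> q"
      using dirr unfolding irr_def by blast
    let ?A = "{c \<in> carrier L. a \<sqsubseteq> c}"
    note A = is_filter_principal[OF a(1)]
    note J = is_filter_filter_join[OF irrD[OF dirr] A]
    have "a \<in> filter_join d ?A" using J(3) a(1) by auto
    then have sub: "d \<subset> filter_join d ?A" using J(2) a(2) by blast
    have "carrier L \<inter> filter_join d ?A \<inter> \<Inter>(D - {d}) \<subseteq> g" if g: "g \<in> G" for g
    proof -
      obtain Z where Z: "Z \<in> \<Z>" "g \<in> Z" using g G by blast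
      then obtain d' where d': "d' \<in> D" "Z \<subseteq> cl {d'}" using ref unfolding refines_def by auto
      have "d' \<in> irr" using d' D by blast
      then have girr: "g \<in> irr" "d' \<subseteq> g" using Z d' cl_singleton[of d'] by auto
      show ?thesis
      proof (cases "d' = d")
        case True
        \<comment> \<open>Otherwise \<open>Z\<close> contains \<open>d\<close> and lies inside
          \<open>cl {d}\<close>, so it equals \<open>cl {d}\<close>, which is not in
          \<open>\<Z>\<close>.\<close>
        have "g \<noteq> d"
        proof
          assume "g = d"
          then have "cl {d} \<subseteq> Z" using Z ZC by (intro cl_least) auto
          then show False using Z d d' True by auto
        qed
        then have "d \<subset> g" using girr True by blast
        then have "a \<in> g" using a(3) irrD[OF girr(1)] by blast
        then have "filter_join d ?A \<subseteq> g"
          using irrD[OF girr(1)] \<open>d \<subset> g\<close> is_filterD(4)[OF irrD[OF girr(1)]]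
          by (intro filter_join_least) auto
        then show ?thesis by blast
      next
        case False
        then show ?thesis using d' girr by blast
      qed
    qed
    then have "carrier L \<inter> filter_join d ?A \<inter> \<Inter>(D - {d}) \<subseteq> p" using G(2) by blast
    then show False using tight d J(1) sub unfolding tight_cover_def by blast
  qed
qed

lemma strongly_spatial_closed_sets: "strongly_spatial closed_sets"
  unfolding strongly_spatial_def
proof (intro conjI ballI allI impI)
  show "join_dense closed_sets (points closed_sets)"
    unfolding join_dense_def points_closed_sets
  proof (intro conjI ballI)
    show "(\<lambda>p. cl {p}) ` irr \<subseteq> carrier closed_sets" using cl_in_carrier by blast
    fix X assume X: "X \<in> carrier closed_sets"
    then have "(\<lambda>p. cl {p}) ` X \<subseteq> (\<lambda>p. cl {p}) ` irr" by auto
    then show "\<exists>A\<subseteq>(\<lambda>p. cl {p}) ` irr. is_lub closed_sets X A"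
      using closed_sets_lub_singletons[OF X] by blast
  qed
next
  fix P \<X> assume "P \<in> points closed_sets" and cov: "join_cover closed_sets P \<X>"
  then obtain p where p: "p \<in> irr" and P: "P = cl {p}" unfolding points_closed_sets by blast
  have XC: "\<X> \<subseteq> carrier closed_sets" using cov unfolding join_cover_def by blast
  have "cl {p} \<subseteq> cl (\<Union>\<X>)"
    using cov P closed_sets_lub[OF XC] unfolding join_cover_def by auto
  then have "p \<in> cl (\<Union>\<X>)" using subset_cl[of "{p}"] p by auto
  then obtain E where E: "finite E" "E \<subseteq> \<Union>\<X>" "carrier L \<inter> \<Inter>E \<subseteq> p" by (rule clE)
  have "\<Union>\<X> \<subseteq> irr" using XC by auto
  then have "E \<subseteq> irr" using E(2) by (rule order.trans[rotated])
  then obtain D where D: "finite D" "D \<subseteq> irr" "carrier L \<inter> \<Inter>D \<subseteq> p" "tight_cover p D D"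
    "\<And>d. d \<in> D \<Longrightarrow> \<exists>e\<in>E. e \<subseteq> d"
    using exists_tight_cover[OF p E(1) _ E(3)] by blast
  \<comment> \<open>Each \<open>d\<close> contains some \<open>e\<close> in \<open>E\<close>, and a
    closed set contains every irreducible filter that extends one of its members.\<close>
  have "\<exists>X\<in>\<X>. cl {d} \<subseteq> X" if d: "d \<in> D" for d
  proof -
    obtain e X where e: "e \<in> E" "e \<subseteq> d" "e \<in> X" "X \<in> \<X>" using D(5)[OF d] E(2) by blast
    have X: "X \<in> carrier closed_sets" using e XC by blast
    have "e \<in> irr" "d \<in> irr" using e d D(2) \<open>E \<subseteq> irr\<close> by auto
    then have "d \<in> cl {e}" using cl_singleton[of e] e(2) by simp
    also have "cl {e} \<subseteq> X" using e(3) by (intro cl_least[OF X]) simp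
    finally have "cl {d} \<subseteq> X" by (intro cl_least[OF X]) simp
    then show ?thesis using e(4) by blast
  qed
  then have "refines closed_sets ((\<lambda>d. cl {d}) ` D) \<X>" unfolding refines_def by auto
  then show "\<exists>I\<subseteq>points closed_sets. minimal_join_cover closed_sets P I \<and> refines closed_sets I \<X>"
    using minimal_join_cover_tight[OF p D(1-4)] D(2) unfolding P points_closed_sets
    by (intro exI[of _ "(\<lambda>d. cl {d}) ` D"]) auto
qed

subsection \<open>Identities\<close>

text \<open>The value of \<open>t\<close> at the filters \<open>F i\<close>, computed in the lattice of filters.\<close>

definition term_filter :: "(nat \<Rightarrow> 'a set) \<Rightarrow> lattice_term \<Rightarrow> 'a set" where
  "term_filter F t = {x \<in> carrier L. \<exists>\<rho>. (\<forall>i. \<rho> i \<in> F i) \<and> term_val L \<rho> t \<sqsubseteq> x}"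

lemma term_val_in_carrier: "(\<And>i. \<rho> i \<in> carrier L) \<Longrightarrow> term_val L \<rho> t \<in> carrier L"
  by (induction t) auto

lemma join_mono:
  assumes "x \<sqsubseteq> x'" "y \<sqsubseteq> y'" "x \<in> carrier L" "x' \<in> carrier L" "y \<in> carrier L" "y' \<in> carrier L"
  shows "x \<squnion> y \<sqsubseteq> x' \<squnion> y'"
  using assms by (meson join_le join_left join_right join_closed le_trans)

lemma meet_mono:
  assumes "x \<sqsubseteq> x'" "y \<sqsubseteq> y'" "x \<in> carrier L" "x' \<in> carrier L" "y \<in> carrier L" "y' \<in> carrier L"
  shows "x \<sqinter> y \<sqsubseteq> x' \<sqinter> y'"
  using assms by (meson meet_le meet_left meet_right meet_closed le_trans)

lemma term_val_mono:
  assumes "\<And>i. \<rho> i \<in> carrier L" "\<And>i. \<sigma> i \<in> carrier L" "\<And>i. \<rho> i \<sqsubseteq> \<sigma> i"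
  shows "term_val L \<rho> t \<sqsubseteq> term_val L \<sigma> t"
  using assms(3)
  by (induction t) (simp_all add: join_mono meet_mono term_val_in_carrier assms(1,2))

lemma term_filter_subset_carrier: "term_filter F t \<subseteq> carrier L"
  unfolding term_filter_def by blast

lemma term_filter_mono: "(\<And>i. F i \<subseteq> G i) \<Longrightarrow> term_filter F t \<subseteq> term_filter G t"
  unfolding term_filter_def by blast

text \<open>Terms are monotone, so the pointwise meet of the two given assignments serves
  both.\<close>

lemma term_filter_common_refinement:
  assumes F: "\<And>i. is_filter (F i)" and x: "x \<in> term_filter F s" and y: "y \<in> term_filter F t"
  obtains \<tau> where "\<forall>i. \<tau> i \<in> F i" "term_val L \<tau> s \<sqsubseteq> x" "term_val L \<tau> t \<sqsubseteq> y"
proof -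
  obtain \<rho> where r: "\<And>i. \<rho> i \<in> F i" "term_val L \<rho> s \<sqsubseteq> x" "x \<in> carrier L"
    using x unfolding term_filter_def by blast
  obtain \<sigma> where s: "\<And>i. \<sigma> i \<in> F i" "term_val L \<sigma> t \<sqsubseteq> y" "y \<in> carrier L"
    using y unfolding term_filter_def by blast
  have C: "\<rho> i \<in> carrier L" "\<sigma> i \<in> carrier L" for i
    using is_filterD(1)[OF F] r(1) s(1) by blast+
  let ?\<tau> = "\<lambda>i. \<rho> i \<sqinter> \<sigma> i"
  have "term_val L ?\<tau> s \<sqsubseteq> term_val L \<rho> s" "term_val L ?\<tau> t \<sqsubseteq> term_val L \<sigma> t"
    using C by (auto intro!: term_val_mono meet_left meet_right)
  then have "term_val L ?\<tau> s \<sqsubseteq> x" "term_val L ?\<tau> t \<sqsubseteq> y"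
    using r(2,3) s(2,3) C by (meson le_trans term_val_in_carrier meet_closed)+
  moreover have "?\<tau> i \<in> F i" for i using is_filterD(3)[OF F r(1) s(1)] .
  ultimately show ?thesis using that[of ?\<tau>] by blast
qed

lemma is_filter_term_filter:
  assumes F: "\<And>i. is_filter (F i)"
  shows "is_filter (term_filter F t)"
  unfolding is_filter_def
proof (intro conjI ballI impI term_filter_subset_carrier)
  have FC: "\<rho> i \<in> carrier L" if "\<And>i. \<rho> i \<in> F i" for \<rho> i
    using is_filterD(1)[OF F] that by blast
  have "\<forall>i. \<exists>x. x \<in> F i" using is_filterD(2)[OF F] by blast
  then obtain \<rho> where "\<And>i. \<rho> i \<in> F i" by metis
  then have "term_val L \<rho> t \<in> term_filter F t"
    unfolding term_filter_def using term_val_in_carrier[of \<rho> t] FC by blast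
  then show "term_filter F t \<noteq> {}" by blast
next
  fix x y assume xy: "x \<in> term_filter F t" "y \<in> term_filter F t"
  then obtain \<tau> where t: "\<forall>i. \<tau> i \<in> F i" "term_val L \<tau> t \<sqsubseteq> x" "term_val L \<tau> t \<sqsubseteq> y"
    using term_filter_common_refinement[where F = F and s = t and t = t, OF F] by blast
  have C: "x \<in> carrier L" "y \<in> carrier L" using xy term_filter_subset_carrier by blast+
  have "\<tau> i \<in> carrier L" for i using is_filterD(1)[OF F] t(1) by blast
  then have "term_val L \<tau> t \<sqsubseteq> x \<sqinter> y" using t C by (intro meet_le term_val_in_carrier) auto
  then show "x \<sqinter> y \<in> term_filter F t" using t(1) C unfolding term_filter_def by auto
next
  fix x y assume x: "x \<in> term_filter F t" and y: "y \<in> carrier L" "x \<sqsubseteq> y"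
  obtain \<rho> where r: "\<And>i. \<rho> i \<in> F i" "term_val L \<rho> t \<sqsubseteq> x" "x \<in> carrier L"
    using x unfolding term_filter_def by blast
  have "\<rho> i \<in> carrier L" for i using is_filterD(1)[OF F] r(1) by blast
  then have "term_val L \<rho> t \<sqsubseteq> y" using r y by (meson le_trans term_val_in_carrier)
  then show "y \<in> term_filter F t" using r y unfolding term_filter_def by blast
qed

text \<open>By this and the next two lemmas, \<open>term_filter\<close> is the recursive evaluation
  in the lattice of filters. Its definition through assignments is what lets identities of
  \<open>L\<close> carry over at once.\<close>

lemma term_filter_Var:
  assumes F: "\<And>i. is_filter (F i)"
  shows "term_filter F (Var n) = F n"
proof (intro equalityI subsetI)
  fix x assume "x \<in> term_filter F (Var n)"
  then obtain \<rho> where "\<And>i. \<rho> i \<in> F i" "\<rho> n \<sqsubseteq> x" "x \<in> carrier L"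
    unfolding term_filter_def by auto
  then show "x \<in> F n" using is_filterD(4)[OF F, of "\<rho> n"] by blast
next
  fix x assume x: "x \<in> F n"
  \<comment> \<open>Variables other than \<open>n\<close> get arbitrary members of their
    filters.\<close>
  have "\<forall>i. \<exists>x. x \<in> F i" using is_filterD(2)[OF F] by blast
  then obtain \<rho> where r: "\<And>i. \<rho> i \<in> F i" by metis
  have "(\<rho>(n := x)) i \<in> F i" for i using x r by simp
  moreover have "x \<in> carrier L" using x is_filterD(1)[OF F] by blast
  moreover have "term_val L (\<rho>(n := x)) (Var n) \<sqsubseteq> x" using calculation(2) by simp
  ultimately show "x \<in> term_filter F (Var n)" unfolding term_filter_def by blast
qed

lemma term_filter_Join:
  assumes F: "\<And>i. is_filter (F i)"
  shows "term_filter F (Join s t) = term_filter F s \<inter> term_filter F t"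
proof (intro equalityI subsetI)
  fix x assume "x \<in> term_filter F (Join s t)"
  then obtain \<rho> where r: "\<And>i. \<rho> i \<in> F i" and x: "x \<in> carrier L"
    and le: "term_val L \<rho> s \<squnion> term_val L \<rho> t \<sqsubseteq> x"
    unfolding term_filter_def by auto
  have "\<rho> i \<in> carrier L" for i using is_filterD(1)[OF F] r(1) by blast
  then have C: "term_val L \<rho> s \<in> carrier L" "term_val L \<rho> t \<in> carrier L"
    by (auto intro: term_val_in_carrier)
  have "term_val L \<rho> s \<sqsubseteq> x" "term_val L \<rho> t \<sqsubseteq> x"
    using le_trans[OF join_left[OF C] le] le_trans[OF join_right[OF C] le] C x by auto
  then show "x \<in> term_filter F s \<inter> term_filter F t" using r x unfolding term_filter_def by blast
next
  fix x assume "x \<in> term_filter F s \<inter> term_filter F t"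
  then have xs: "x \<in> term_filter F s" and xt: "x \<in> term_filter F t" by auto
  then have x: "x \<in> carrier L" using term_filter_subset_carrier by blast
  obtain \<tau> where t: "\<forall>i. \<tau> i \<in> F i" "term_val L \<tau> s \<sqsubseteq> x" "term_val L \<tau> t \<sqsubseteq> x"
    by (rule term_filter_common_refinement[where F = F, OF F xs xt])
  have "\<tau> i \<in> carrier L" for i using is_filterD(1)[OF F] t(1) by blast
  then have "term_val L \<tau> (Join s t) \<sqsubseteq> x"
    using t x by (auto intro!: join_le term_val_in_carrier)
  then show "x \<in> term_filter F (Join s t)" using t(1) x unfolding term_filter_def by blast
qed

lemma term_filter_Meet:
  assumes F: "\<And>i. is_filter (F i)"
  shows "term_filter F (Meet s t) = filter_join (term_filter F s) (term_filter F t)"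
proof (intro equalityI subsetI)
  fix x assume "x \<in> term_filter F (Meet s t)"
  then obtain \<rho> where r: "\<And>i. \<rho> i \<in> F i" and x: "x \<in> carrier L"
    and le: "term_val L \<rho> s \<sqinter> term_val L \<rho> t \<sqsubseteq> x"
    unfolding term_filter_def by auto
  have "\<rho> i \<in> carrier L" for i using is_filterD(1)[OF F] r(1) by blast
  then have C: "term_val L \<rho> s \<in> carrier L" "term_val L \<rho> t \<in> carrier L"
    by (auto intro: term_val_in_carrier)
  then have "term_val L \<rho> s \<in> term_filter F s" "term_val L \<rho> t \<in> term_filter F t"
    using r le_refl[OF C(1)] le_refl[OF C(2)] unfolding term_filter_def by blast+
  then show "x \<in> filter_join (term_filter F s) (term_filter F t)"
    using le x unfolding filter_join_def by blast
next
  fix x assume "x \<in> filter_join (term_filter F s) (term_filter F t)"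
  then obtain u v where u: "u \<in> term_filter F s" and v: "v \<in> term_filter F t"
    and le: "u \<sqinter> v \<sqsubseteq> x" and x: "x \<in> carrier L"
    unfolding filter_join_def by blast
  obtain \<tau> where t: "\<forall>i. \<tau> i \<in> F i" "term_val L \<tau> s \<sqsubseteq> u" "term_val L \<tau> t \<sqsubseteq> v"
    by (rule term_filter_common_refinement[where F = F, OF F u v])
  have tC: "\<tau> i \<in> carrier L" for i using is_filterD(1)[OF F] t(1) by blast
  have C: "u \<in> carrier L" "v \<in> carrier L" using u v term_filter_subset_carrier by blast+
  have "term_val L \<tau> (Meet s t) \<sqsubseteq> u \<sqinter> v"
    using t C tC by (simp add: meet_mono term_val_in_carrier)
  then have "term_val L \<tau> (Meet s t) \<sqsubseteq> x"
    by (rule le_trans[OF _ le]) (use x C in \<open>auto intro!: meet_closed term_val_in_carrier tC\<close>)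
  then show "x \<in> term_filter F (Meet s t)" using t(1) x unfolding term_filter_def by blast
qed

section \<open>Terms evaluated at closed sets\<close>

lemma term_val_closed_sets_carrier:
  assumes "\<And>i. \<rho> i \<in> carrier closed_sets"
  shows "term_val closed_sets \<rho> t \<in> carrier closed_sets"
proof -
  interpret M: complete_lattice closed_sets by (rule complete_lattice_closed_sets)
  show ?thesis
    by (induction t) (simp_all add: assms del: closed_sets_simps)
qed

text \<open>Adding filters to \<open>E\<close> only shrinks the term filter, so witnesses for
  different subterms can be united pointwise. The converse for joins rests on
  \<open>irr_join_decomposition\<close>, applied to the two filters whose intersection is the value
  of the join.\<close>

lemma mem_term_val_closed_sets:
  assumes \<rho>: "\<And>i. \<rho> i \<in> carrier closed_sets" and "p \<in> irr"
  shows "p \<in> term_val closed_sets \<rho> t \<longleftrightarrow>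
    (\<exists>E. (\<forall>i. finite (E i) \<and> E i \<subseteq> \<rho> i) \<and> term_filter (\<lambda>i. carrier L \<inter> \<Inter>(E i)) t \<subseteq> p)"
  using assms(2)
proof (induction t arbitrary: p)
  have ne: "carrier L \<noteq> {}" if "p \<in> irr" for p using that unfolding irr_def by blast
  have fil: "is_filter (carrier L \<inter> \<Inter>(E i))"
    if "\<forall>i. finite (E i) \<and> E i \<subseteq> \<rho> i" "p \<in> irr" for E i p
  proof (rule is_filter_Inter[OF ne[OF that(2)]])
    have "\<rho> i \<subseteq> irr" using \<rho>[of i] by simp
    then show "is_filter q" if "q \<in> E i" for q
      using that \<open>\<forall>i. finite (E i) \<and> E i \<subseteq> \<rho> i\<close> irrD by blast
  qed (use that in blast)
  let ?T = "\<lambda>E. term_filter (\<lambda>i. carrier L \<inter> \<Inter>(E i))"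
  have T_Var: "?T E (Var n) = carrier L \<inter> \<Inter>(E n)"
    and T_Join: "?T E (Join s t) = ?T E s \<inter> ?T E t"
    and T_Meet: "?T E (Meet s t) = filter_join (?T E s) (?T E t)"
    and T_filter: "is_filter (?T E s)"
    if "\<forall>i. finite (E i) \<and> E i \<subseteq> \<rho> i" "p \<in> irr" for E n s t p
    by (rule term_filter_Var term_filter_Join term_filter_Meet is_filter_term_filter, rule fil[OF that])+
  {
    case (Var n)
    note p = Var
    show ?case
    proof
      assume "p \<in> term_val closed_sets \<rho> (Var n)"
      then have pn: "p \<in> \<rho> n" by simp
      \<comment> \<open>Empty families at the other variables meet the constraint trivially, and the
        value of \<open>Var n\<close> depends only on the family at \<open>n\<close>.\<close>
      let ?E = "(\<lambda>_. {})(n := {p})"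
      have E: "\<forall>i. finite (?E i) \<and> ?E i \<subseteq> \<rho> i" using pn by simp
      have "term_filter (\<lambda>i. carrier L \<inter> \<Inter>(?E i)) (Var n) \<subseteq> p"
        using T_Var[OF E p, of n] by simp
      then show "\<exists>E. (\<forall>i. finite (E i) \<and> E i \<subseteq> \<rho> i) \<and>
          ?T E (Var n) \<subseteq> p"
        using E by blast
    next
      assume "\<exists>E. (\<forall>i. finite (E i) \<and> E i \<subseteq> \<rho> i) \<and>
          ?T E (Var n) \<subseteq> p"
      then obtain E where E: "\<forall>i. finite (E i) \<and> E i \<subseteq> \<rho> i"
        and le: "?T E (Var n) \<subseteq> p" by blast
      have "carrier L \<inter> \<Inter>(E n) \<subseteq> p" using le T_Var[OF E p] by simp
      then have "p \<in> cl (\<rho> n)" using E p by (intro clI[of p "E n"]) auto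
      then show "p \<in> term_val closed_sets \<rho> (Var n)" using \<rho>[of n] by auto
    qed
  next
    case (Join s t)
    note p = Join.prems
    let ?s = "term_val closed_sets \<rho> s" and ?t = "term_val closed_sets \<rho> t"
    have sub: "?s \<subseteq> irr" "?t \<subseteq> irr" using term_val_closed_sets_carrier[OF \<rho>] by auto
    have val: "term_val closed_sets \<rho> (Join s t) = cl (?s \<union> ?t)"
      using join_closed_sets[OF term_val_closed_sets_carrier[OF \<rho>] term_val_closed_sets_carrier[OF \<rho>]]
      by simp
    show ?case
    proof
      assume "p \<in> term_val closed_sets \<rho> (Join s t)"
      then obtain H where H: "finite H" "H \<subseteq> ?s \<union> ?t" "carrier L \<inter> \<Inter>H \<subseteq> p"
        unfolding val by (rule clE)
      have "\<exists>E. (\<forall>i. finite (E i) \<and> E i \<subseteq> \<rho> i) \<and>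
          (?T E s \<subseteq> h \<or> ?T E t \<subseteq> h)"
        if h: "h \<in> H" for h
      proof -
        have "h \<in> irr" using h H(2) sub by blast
        then show ?thesis using h H(2) Join.IH[of h] by blast
      qed
      then obtain E where E: "\<And>h i. h \<in> H \<Longrightarrow> finite (E h i) \<and> E h i \<subseteq> \<rho> i"
        "\<And>h. h \<in> H \<Longrightarrow> ?T (E h) s \<subseteq> h \<or>
           ?T (E h) t \<subseteq> h"
        by metis
      \<comment> \<open>These unions stay finite because \<open>H\<close> is, and they put the value
        of the join inside every member of \<open>H\<close> simultaneously.\<close>
      define E' where "E' i = (\<Union>h\<in>H. E h i)" for i
      have E': "\<forall>i. finite (E' i) \<and> E' i \<subseteq> \<rho> i" using E(1) H(1) unfolding E'_def by blast
      have mono: "?T E' u \<subseteq> ?T (E h) u"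
        if "h \<in> H" for h u
      proof (rule term_filter_mono)
        fix i
        have "E h i \<subseteq> E' i" using that unfolding E'_def by blast
        then show "carrier L \<inter> \<Inter>(E' i) \<subseteq> carrier L \<inter> \<Inter>(E h i)"
          by (intro Int_mono Inter_anti_mono order_refl)
      qed
      have "?T E' (Join s t) \<subseteq> h" if "h \<in> H" for h
        using E(2)[OF that] mono[OF that, of s] mono[OF that, of t] unfolding T_Join[OF E' p] by blast
      then have "?T E' (Join s t) \<subseteq> carrier L \<inter> \<Inter>H"
        by (intro Int_greatest term_filter_subset_carrier Inter_greatest)
      then have "?T E' (Join s t) \<subseteq> p" using H(3) by (rule order.trans)
      then show "\<exists>E. (\<forall>i. finite (E i) \<and> E i \<subseteq> \<rho> i) \<and>
          ?T E (Join s t) \<subseteq> p"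
        using E' by (intro exI[of _ E'] conjI)
    next
      assume "\<exists>E. (\<forall>i. finite (E i) \<and> E i \<subseteq> \<rho> i) \<and>
          ?T E (Join s t) \<subseteq> p"
      then obtain E where E: "\<forall>i. finite (E i) \<and> E i \<subseteq> \<rho> i"
        and le: "?T E (Join s t) \<subseteq> p" by blast
      let ?F = "\<lambda>i. carrier L \<inter> \<Inter>(E i)"
      have "term_filter ?F s \<inter> term_filter ?F t \<subseteq> p"
        using le T_Join[OF E p] by simp
      then obtain H where H: "finite H" "H \<subseteq> irr"
        "\<forall>q\<in>H. term_filter ?F s \<subseteq> q \<or> term_filter ?F t \<subseteq> q"
        "carrier L \<inter> \<Inter>H \<subseteq> p"
        by (rule irr_join_decomposition[OF p T_filter[OF E p] T_filter[OF E p]])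
      have "H \<subseteq> ?s \<union> ?t"
      proof
        fix q assume q: "q \<in> H"
        then have "q \<in> irr" using H(2) by blast
        then show "q \<in> ?s \<union> ?t" using bspec[OF H(3) q] E Join.IH[of q] by blast
      qed
      then show "p \<in> term_val closed_sets \<rho> (Join s t)"
        unfolding val by (rule clI[OF p H(1) _ H(4)])
    qed
  next
    case (Meet s t)
    note p = Meet.prems
    let ?s = "term_val closed_sets \<rho> s" and ?t = "term_val closed_sets \<rho> t"
    have val: "term_val closed_sets \<rho> (Meet s t) = ?s \<inter> ?t"
      using meet_closed_sets[OF term_val_closed_sets_carrier[OF \<rho>] term_val_closed_sets_carrier[OF \<rho>]]
      by simp
    show ?case
    proof
      assume "p \<in> term_val closed_sets \<rho> (Meet s t)"
      then have "p \<in> ?s" "p \<in> ?t" unfolding val by auto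
      then obtain E E' where E: "\<forall>i. finite (E i) \<and> E i \<subseteq> \<rho> i" "\<forall>i. finite (E' i) \<and> E' i \<subseteq> \<rho> i"
        and le: "?T E s \<subseteq> p"
          "?T E' t \<subseteq> p"
        using Meet.IH[OF p] by blast
      let ?F = "\<lambda>i. carrier L \<inter> \<Inter>(E i \<union> E' i)"
      have U: "\<forall>i. finite (E i \<union> E' i) \<and> E i \<union> E' i \<subseteq> \<rho> i" using E by blast
      have "term_filter ?F s \<subseteq> ?T E s"
        "term_filter ?F t \<subseteq> ?T E' t"
        by (auto intro!: term_filter_mono)
      then have "filter_join (term_filter ?F s) (term_filter ?F t) \<subseteq> p"
        using le by (intro filter_join_least[OF irrD[OF p]]) auto
      then have "term_filter ?F (Meet s t) \<subseteq> p"
        using T_Meet[OF U p] by simp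
      then show "\<exists>E. (\<forall>i. finite (E i) \<and> E i \<subseteq> \<rho> i) \<and>
          ?T E (Meet s t) \<subseteq> p"
        using U by (intro exI[of _ "\<lambda>i. E i \<union> E' i"] conjI)
    next
      assume "\<exists>E. (\<forall>i. finite (E i) \<and> E i \<subseteq> \<rho> i) \<and>
          ?T E (Meet s t) \<subseteq> p"
      then obtain E where E: "\<forall>i. finite (E i) \<and> E i \<subseteq> \<rho> i"
        and le: "?T E (Meet s t) \<subseteq> p" by blast
      let ?F = "\<lambda>i. carrier L \<inter> \<Inter>(E i)"
      note J = is_filter_filter_join[OF T_filter[OF E p]
          T_filter[OF E p]]
      have "filter_join (term_filter ?F s) (term_filter ?F t) \<subseteq> p"
        using le T_Meet[OF E p] by simp
      then have "term_filter ?F s \<subseteq> p" "term_filter ?F t \<subseteq> p"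
        using J(2)[of s t] J(3)[of t s] by (meson order.trans)+
      then show "p \<in> term_val closed_sets \<rho> (Meet s t)"
        unfolding val using Meet.IH[OF p] E by blast
    qed
  }
qed

lemma closed_sets_in_variety: "in_variety_of closed_sets L"
  unfolding in_variety_of_def
proof (intro conjI allI impI)
  show "lattice closed_sets"
    using complete_lattice_closed_sets by (rule complete_lattice_lattice)
  fix s t assume id: "satisfies_identity L s t"
  show "satisfies_identity closed_sets s t"
    unfolding satisfies_identity_def
  proof
    fix \<rho> :: "nat \<Rightarrow> 'a set set" assume "\<rho> \<in> UNIV \<rightarrow> carrier closed_sets"
    then have \<rho>: "\<rho> i \<in> carrier closed_sets" for i by (rule funcset_mem) simp
    \<comment> \<open>An identity of \<open>L\<close> equates the values under every assignment into
      the carrier, hence also the sets of elements above such values.\<close>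
    have eq: "term_filter F s = term_filter F t" if F: "\<And>i. F i \<subseteq> carrier L" for F
    proof -
      have "term_val L \<sigma> s = term_val L \<sigma> t" if "\<forall>i. \<sigma> i \<in> F i" for \<sigma>
        using id that F unfolding satisfies_identity_def Pi_def by blast
      then show ?thesis unfolding term_filter_def by metis
    qed
    have "p \<in> term_val closed_sets \<rho> s \<longleftrightarrow> p \<in> term_val closed_sets \<rho> t" if "p \<in> irr" for p
      unfolding mem_term_val_closed_sets[where \<rho> = \<rho>, OF \<rho> that] by (simp only: eq[OF Int_lower1])
    moreover have "term_val closed_sets \<rho> s \<subseteq> irr" "term_val closed_sets \<rho> t \<subseteq> irr"
      using term_val_closed_sets_carrier[OF \<rho>] by auto
    ultimately show "term_val closed_sets \<rho> s = term_val closed_sets \<rho> t" by blast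
  qed
qed

subsection \<open>The embedding\<close>

text \<open>In the reversed order, these are the irreducible filters below the principal filter of
  \<open>x\<close>.\<close>

definition irr_above :: "'a \<Rightarrow> 'a set set" where
  "irr_above x = {p \<in> irr. x \<in> p}"

lemma irr_above_carrier:
  assumes "x \<in> carrier L"
  shows "irr_above x \<in> carrier closed_sets"
proof -
  have "cl (irr_above x) \<subseteq> irr_above x"
  proof
    fix p assume "p \<in> cl (irr_above x)"
    then obtain E where "p \<in> irr" "E \<subseteq> irr_above x" "carrier L \<inter> \<Inter>E \<subseteq> p" by (rule clE)
    then show "p \<in> irr_above x" using assms unfolding irr_above_def by blast
  qed
  then show ?thesis unfolding irr_above_def by auto
qed

text \<open>If \<open>x\<close> is not below \<open>y\<close>, the principal filter of
  \<open>x\<close> omits \<open>y\<close>, and so does some irreducible filter extending it.\<close>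

lemma irr_above_inj: "inj_on irr_above (carrier L)"
proof -
  have le: "x \<sqsubseteq> y" if "irr_above x = irr_above y" and xy: "x \<in> carrier L" "y \<in> carrier L" for x y
  proof (rule ccontr)
    assume "\<not> x \<sqsubseteq> y"
    then obtain p where "p \<in> irr" "{c \<in> carrier L. x \<sqsubseteq> c} \<subseteq> p" "y \<notin> p"
      using exists_irr_separating[OF is_filter_principal[OF xy(1)] xy(2)] by blast
    then show False using that unfolding irr_above_def by blast
  qed
  show ?thesis
    by (rule inj_onI) (simp add: le le_antisym)
qed

lemma irr_above_meet:
  assumes "x \<in> carrier L" "y \<in> carrier L"
  shows "irr_above (x \<sqinter> y) = irr_above x \<inter> irr_above y"
proof -
  have "x \<sqinter> y \<in> p \<longleftrightarrow> x \<in> p \<and> y \<in> p" if "p \<in> irr" for p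
    using is_filterD(3)[OF irrD[OF that], of x y] is_filterD(4)[OF irrD[OF that], of "x \<sqinter> y"]
      meet_left[OF assms] meet_right[OF assms] assms by blast
  then show ?thesis unfolding irr_above_def by blast
qed

text \<open>If \<open>x \<squnion> y \<in> p\<close>, then \<open>p\<close> contains the
  intersection of the principal filters of \<open>x\<close> and \<open>y\<close>, and
  \<open>irr_join_decomposition\<close> gives the nontrivial inclusion.\<close>

lemma irr_above_join:
  assumes x: "x \<in> carrier L" and y: "y \<in> carrier L"
  shows "irr_above (x \<squnion> y) = cl (irr_above x \<union> irr_above y)"
proof (intro equalityI subsetI)
  fix p assume "p \<in> irr_above (x \<squnion> y)"
  then have p: "p \<in> irr" "x \<squnion> y \<in> p" unfolding irr_above_def by auto
  have "c \<in> p" if c: "c \<in> carrier L" "x \<sqsubseteq> c" "y \<sqsubseteq> c" for c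
    by (rule is_filterD(4)[OF irrD[OF p(1)] p(2) join_le[OF c(2,3) x y c(1)] c(1)])
  then have "{c \<in> carrier L. x \<sqsubseteq> c} \<inter> {c \<in> carrier L. y \<sqsubseteq> c} \<subseteq> p" by blast
  then obtain H where H: "finite H" "H \<subseteq> irr"
    "\<forall>q\<in>H. {c \<in> carrier L. x \<sqsubseteq> c} \<subseteq> q \<or> {c \<in> carrier L. y \<sqsubseteq> c} \<subseteq> q"
    "carrier L \<inter> \<Inter>H \<subseteq> p"
    by (rule irr_join_decomposition[OF p(1) is_filter_principal[OF x] is_filter_principal[OF y]])
  have "H \<subseteq> irr_above x \<union> irr_above y"
  proof
    fix q assume q: "q \<in> H"
    show "q \<in> irr_above x \<union> irr_above y"
      using bspec[OF H(3) q] q H(2) x y unfolding irr_above_def by auto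
  qed
  then show "p \<in> cl (irr_above x \<union> irr_above y)" by (rule clI[OF p(1) H(1) _ H(4)])
next
  fix p assume "p \<in> cl (irr_above x \<union> irr_above y)"
  moreover have "irr_above x \<subseteq> irr_above (x \<squnion> y)" "irr_above y \<subseteq> irr_above (x \<squnion> y)"
    using is_filterD(4)[OF irrD _ join_left[OF x y] join_closed[OF x y]]
      is_filterD(4)[OF irrD _ join_right[OF x y] join_closed[OF x y]]
    unfolding irr_above_def by auto
  then have "cl (irr_above x \<union> irr_above y) \<subseteq> irr_above (x \<squnion> y)"
    by (intro cl_least irr_above_carrier join_closed x y Un_least)
  ultimately show "p \<in> irr_above (x \<squnion> y)" by blast
qed

lemma embeds_closed_sets: "embeds_within_variety L closed_sets irr_above"
proof -
  have "lattice closed_sets"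
    using complete_lattice_closed_sets by (rule complete_lattice_lattice)
  then show ?thesis
    unfolding embeds_within_variety_def lattice_embedding_def join_pres_def meet_pres_def
    using lattice_axioms closed_sets_in_variety irr_above_inj
    by (simp add: irr_above_carrier join_closed_sets meet_closed_sets irr_above_join irr_above_meet
        del: closed_sets_simps)
qed

text \<open>Irreducible filters are proper, so none contains a least element, and the image of
  \<open>z\<close> is the empty set.\<close>

lemma irr_above_least:
  assumes z: "least L z (carrier L)"
  shows "least closed_sets (irr_above z) (carrier closed_sets)"
proof -
  have "z \<notin> p" if "p \<in> irr" for p
  proof
    assume "z \<in> p"
    have "carrier L \<subseteq> p"
    proof
      fix c assume "c \<in> carrier L"
      then show "c \<in> p" using is_filterD(4)[OF irrD[OF that] \<open>z \<in> p\<close>] least_le[OF z] by simp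
    qed
    then show False using that unfolding irr_def by blast
  qed
  then have "irr_above z = {}" unfolding irr_above_def by blast
  then show ?thesis using irr_above_carrier[OF least_closed[OF z]] unfolding least_def by simp
qed

end

theorem corollary7p5:
  fixes L :: "('a, 'b) gorder_scheme"
  assumes "modular_lattice L"
  shows "(\<exists>(M :: 'a set set gorder) f.
            embeds_within_variety L M f \<and> algebraic_lattice M \<and> strongly_spatial M) \<and>
         (\<forall>z. least L z (carrier L) \<longrightarrow>
            (\<exists>(M :: 'a set set gorder) f.
               embeds_within_variety L M f \<and> algebraic_lattice M \<and> strongly_spatial M \<and>
               least M (f z) (carrier M)))"
proof -
  interpret modular_lattice L by (rule assms)
  show ?thesis
    using embeds_closed_sets algebraic_closed_sets strongly_spatial_closed_sets irr_above_least
    by blast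
qed

end
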